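(* Let $s\geq 2$ and $n\geq 15(s-1)$ be integers, and let $G$ be a graph of order $n$ with complement $\overline{G}$. Then \[ |\mu_s(G)|+|\mu_s(\overline{G})|\leq\frac{n}{\sqrt{2(s-1)}}-1. \]
   Context: Graphs are finite and simple. For a graph $G$ of order $n$, $\mu_1(G)\geq\mu_2(G)\geq\cdots\geq\mu_n(G)$ denote the eigenvalues of its adjacency matrix, and $\overline{G}$ denotes the complement of $G$. *)

theory Defs
  imports
    "Graph_Theory.Pair_Digraph"
    "Jordan_Normal_Form.Char_Poly"
begin

definition graph_complement :: "'a pair_pre_digraph \<Rightarrow> 'a pair_pre_digraph" where
  "graph_complement G =
     \<lparr> pverts = pverts G,
       parcs = {(u, v). u \<in> pverts G \<and> v \<in> pverts G \<and> u \<noteq> v \<and> (u, v) \<notin> parcs G} \<rparr>"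

lemma pair_graph_complement:
  assumes "pair_graph G"
  shows "pair_graph (graph_complement G)"
proof -
  interpret pair_graph G by fact
  have "finite (pverts G \<times> pverts G)"
    by (simp add: pair_finite_verts)
  then have fin: "finite (parcs (graph_complement G))"
    by (rule rev_finite_subset) (auto simp: graph_complement_def)
  have "sym (parcs G)"
    using pair_sym_arcs by (simp add: symmetric_def)
  then have "sym (parcs (graph_complement G))"
    by (auto simp: graph_complement_def sym_def)
  with fin show ?thesis
    by unfold_locales (auto simp: graph_complement_def symmetric_def pair_finite_verts)
qed

definition adjacency_mat :: "'a list \<Rightarrow> 'a pair_pre_digraph \<Rightarrow> real mat" where
  "adjacency_mat vs G =
     mat (length vs) (length vs) (\<lambda>(i, j). if (vs ! i, vs ! j) \<in> parcs G then 1 else 0)"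

text \<open>
  The eigenvalues of a matrix in weakly decreasing order, repeated according to their
  algebraic multiplicity as roots of the characteristic polynomial.
\<close>

definition eigenvalues_desc :: "real mat \<Rightarrow> real list" where
  "eigenvalues_desc A = rev (sorted_list_of_multiset (proots (char_poly A)))"

text \<open>
  The vertices of a graph carry no order, so an enumeration of them is picked; by
  \<open>graph_eigenvalue_eq\<close> below its choice does not matter. The index is 1-based,
  so the largest eigenvalue is \<open>graph_eigenvalue G 1\<close>, and the list has one entry
  per vertex (\<open>length_eigenvalues_desc_adjacency_mat\<close>).
\<close>

definition graph_eigenvalue :: "'a pair_pre_digraph \<Rightarrow> nat \<Rightarrow> real" where
  "graph_eigenvalue G k =
     eigenvalues_desc
       (adjacency_mat (SOME vs. distinct vs \<and> set vs = pverts G) G) ! (k - 1)"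

lemma adjacency_mat_similar:
  assumes "distinct vs" "distinct ws" "set vs = set ws"
  shows "similar_mat (adjacency_mat vs G) (adjacency_mat ws G)"
proof -
  define n where "n = length vs"
  have n: "length ws = n" using assms n_def by (metis distinct_card)
  have "\<forall>i<n. \<exists>k<n. ws ! k = vs ! i"
    using assms n n_def by (metis in_set_conv_nth)
  then obtain p where p: "\<And>i. i < n \<Longrightarrow> p i < n \<and> ws ! p i = vs ! i" by metis
  have "inj_on p {..<n}"
    using p assms(1) unfolding n_def by (metis (no_types, lifting) inj_onI lessThan_iff nth_eq_iff_index_eq)
  then have bij: "bij_betw p {..<n} {..<n}"
    using p by (metis (no_types, lifting) bij_betw_def card_image card_subset_eq finite_lessThan image_subsetI lessThan_iff)
  define q where "q = inv_into {..<n} p"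
  have q: "q k < n" "p (q k) = k" if "k < n" for k
    using bij that unfolding q_def bij_betw_def
    by (metis inv_into_into lessThan_iff, metis f_inv_into_f lessThan_iff)
  have qp: "q (p i) = i" if "i < n" for i
    using bij that unfolding q_def by (simp add: bij_betw_inv_into_left)
  define P where "P = mat n n (\<lambda>(i, j). if j = p i then 1 else 0 :: real)"
  define Q where "Q = mat n n (\<lambda>(i, j). if i = p j then 1 else 0 :: real)"
  have "P * Q = 1\<^sub>m n"
  proof (intro eq_matI)
    fix i j assume "i < dim_row (1\<^sub>m n :: real mat)" "j < dim_col (1\<^sub>m n :: real mat)"
    then have ij: "i < n" "j < n" by auto
    have "(P * Q) $$ (i, j) = (\<Sum>k\<in>{0..<n}. (if k = p i then 1 else 0) * (if k = p j then 1 else 0))"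
      using ij by (simp add: P_def Q_def scalar_prod_def)
    also have "\<dots> = (\<Sum>k\<in>{0..<n}. if k = p i then (if p i = p j then 1 else 0) else 0)"
      by (rule sum.cong) auto
    also have "\<dots> = (if p i = p j then 1 else 0)" using ij p by simp
    also have "\<dots> = 1\<^sub>m n $$ (i, j)" using ij qp by (metis index_one_mat(1))
    finally show "(P * Q) $$ (i, j) = 1\<^sub>m n $$ (i, j)" .
  qed (auto simp: P_def Q_def)
  moreover have "Q * P = 1\<^sub>m n"
  proof (intro eq_matI)
    fix i j assume "i < dim_row (1\<^sub>m n :: real mat)" "j < dim_col (1\<^sub>m n :: real mat)"
    then have ij: "i < n" "j < n" by auto
    have "(Q * P) $$ (i, j) = (\<Sum>k\<in>{0..<n}. (if i = p k then 1 else 0) * (if j = p k then 1 else 0))"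
      using ij by (simp add: P_def Q_def scalar_prod_def)
    also have "\<dots> = (\<Sum>k\<in>{0..<n}. if k = q i then (if i = j then 1 else 0) else 0)"
    proof (rule sum.cong)
      fix k assume "k \<in> {0..<n}"
      then have k: "k < n" by simp
      have e: "i = p k \<longleftrightarrow> k = q i" "j = p k \<longleftrightarrow> k = q j"
        using q(2)[OF ij(1)] q(2)[OF ij(2)] qp[OF k] by metis+
      have "q i = q j \<longleftrightarrow> i = j"
        using q(2)[OF ij(1)] q(2)[OF ij(2)] by metis
      then show "(if i = p k then 1 else 0) * (if j = p k then 1 else 0)
          = (if k = q i then (if i = j then 1 else 0) else (0::real))"
        unfolding e by auto
    qed simp
    also have "\<dots> = 1\<^sub>m n $$ (i, j)" using ij q(1)[OF ij(1)] by simp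
    finally show "(Q * P) $$ (i, j) = 1\<^sub>m n $$ (i, j)" .
  qed (auto simp: P_def Q_def)
  moreover have "adjacency_mat vs G = P * adjacency_mat ws G * Q"
  proof (intro eq_matI)
    fix i j assume "i < dim_row (P * adjacency_mat ws G * Q)" "j < dim_col (P * adjacency_mat ws G * Q)"
    then have ij: "i < n" "j < n" by (auto simp: P_def Q_def)
    have PA: "(P * adjacency_mat ws G) $$ (i, k) = adjacency_mat ws G $$ (p i, k)" if "k < n" for k
    proof -
      have "(P * adjacency_mat ws G) $$ (i, k)
          = (\<Sum>l\<in>{0..<n}. (if l = p i then 1 else 0) * adjacency_mat ws G $$ (l, k))"
        using ij that n by (simp add: P_def adjacency_mat_def scalar_prod_def)
      also have "\<dots> = (\<Sum>l\<in>{0..<n}. if l = p i then adjacency_mat ws G $$ (p i, k) else 0)"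
        by (rule sum.cong) auto
      finally show ?thesis using p ij by simp
    qed
    have "(P * adjacency_mat ws G * Q) $$ (i, j)
        = (\<Sum>k\<in>{0..<n}. (P * adjacency_mat ws G) $$ (i, k) * (if k = p j then 1 else 0))"
      using ij n by (simp add: P_def Q_def adjacency_mat_def scalar_prod_def)
    also have "\<dots> = (\<Sum>k\<in>{0..<n}. if k = p j then (P * adjacency_mat ws G) $$ (i, p j) else 0)"
      by (rule sum.cong) auto
    also have "\<dots> = (P * adjacency_mat ws G) $$ (i, p j)"
      using p ij by simp
    also have "\<dots> = adjacency_mat vs G $$ (i, j)"
      using PA p ij n by (simp add: adjacency_mat_def n_def)
    finally show "adjacency_mat vs G $$ (i, j) = (P * adjacency_mat ws G * Q) $$ (i, j)" by simp
  qed (auto simp: P_def Q_def adjacency_mat_def n_def)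
  ultimately show ?thesis
    by (intro similar_matI[where n = n and P = P and Q = Q])
       (auto simp: adjacency_mat_def P_def Q_def n n_def)
qed

lemma graph_eigenvalue_eq:
  assumes "distinct vs" "set vs = pverts G"
  shows "graph_eigenvalue G k = eigenvalues_desc (adjacency_mat vs G) ! (k - 1)"
proof -
  define ws where "ws = (SOME vs. distinct vs \<and> set vs = pverts G)"
  have "distinct ws \<and> set ws = pverts G"
    unfolding ws_def by (rule someI[of _ vs]) (use assms in simp)
  then have "similar_mat (adjacency_mat ws G) (adjacency_mat vs G)"
    using assms by (intro adjacency_mat_similar) auto
  then show ?thesis
    unfolding graph_eigenvalue_def eigenvalues_desc_def ws_def[symmetric]
    by (simp add: char_poly_similar)
qed

lemma real_symmetric_char_poly_splits:
  fixes A :: "real mat"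
  assumes A: "A \<in> carrier_mat n n" and sym: "\<And>i j. i < n \<Longrightarrow> j < n \<Longrightarrow> A $$ (i, j) = A $$ (j, i)"
  obtains es where "char_poly A = (\<Prod>e\<leftarrow>es. [:- e, 1:])" "length es = n"
proof -
  interpret h: inj_comm_ring_hom complex_of_real
    by unfold_locales auto
  interpret hp: map_poly_inj_comm_ring_hom complex_of_real ..
  have hc: "comm_ring_hom complex_of_real"
    by unfold_locales auto
  define C where "C = map_mat complex_of_real A"
  have C: "C \<in> carrier_mat n n" using A by (simp add: C_def)
  obtain as where as: "char_poly C = (\<Prod>a\<leftarrow>as. [:- a, 1:])" "length as = n"
    using char_poly_factorized[OF C] by blast
  have re: "complex_of_real (Re a) = a" if "a \<in> set as" for a
  proof -
    have "poly (char_poly C) a = 0"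
      unfolding as(1) using that by (auto simp: poly_prod_list prod_list_zero_iff)
    then obtain v where v: "v \<in> carrier_vec n" "v \<noteq> 0\<^sub>v n" "C *\<^sub>v v = a \<cdot>\<^sub>v v"
      using eigenvalue_root_char_poly[OF C] C unfolding eigenvalue_def eigenvector_def by auto
    define S where "S = (\<Sum>i\<in>{0..<n}. \<Sum>j\<in>{0..<n}. C $$ (i, j) * v $ j * cnj (v $ i))"
    define N where "N = (\<Sum>i\<in>{0..<n}. v $ i * cnj (v $ i))"
    have Cv: "(\<Sum>j\<in>{0..<n}. C $$ (i, j) * v $ j) = a * v $ i" if "i < n" for i
      using arg_cong[OF v(3), of "\<lambda>w. w $ i"] that C v(1)
      by (simp add: scalar_prod_def)
    have "S = (\<Sum>i\<in>{0..<n}. (\<Sum>j\<in>{0..<n}. C $$ (i, j) * v $ j) * cnj (v $ i))"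
      by (simp add: S_def sum_distrib_right)
    also have "\<dots> = (\<Sum>i\<in>{0..<n}. a * v $ i * cnj (v $ i))"
      by (rule sum.cong) (simp_all add: Cv)
    also have "\<dots> = a * N"
      by (simp add: N_def sum_distrib_left mult.assoc)
    finally have S: "S = a * N" .
    have "cnj S = (\<Sum>i\<in>{0..<n}. \<Sum>j\<in>{0..<n}. C $$ (j, i) * v $ i * cnj (v $ j))"
      unfolding S_def cnj_sum
      using A sym by (intro sum.cong refl) (simp add: C_def)
    also have "\<dots> = S"
      unfolding S_def by (rule sum.swap)
    finally have "cnj S = S" .
    moreover have Nc: "cnj N = N"
      by (simp add: N_def mult.commute)
    moreover have "N \<noteq> 0"
    proof
      assume "N = 0"
      have "N = of_real (\<Sum>i\<in>{0..<n}. (cmod (v $ i))\<^sup>2)"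
        by (simp add: N_def complex_norm_square[symmetric] del: of_real_power)
      with \<open>N = 0\<close> have "(\<Sum>i\<in>{0..<n}. (cmod (v $ i))\<^sup>2) = 0"
        by (metis of_real_eq_0_iff)
      then have "\<forall>i\<in>{0..<n}. v $ i = 0"
        by (subst (asm) sum_nonneg_eq_0_iff) auto
      then have "v = 0\<^sub>v n" using v(1) by (intro eq_vecI) auto
      with v(2) show False by simp
    qed
    ultimately have "cnj a = a" using S by simp
    then show ?thesis by (metis Reals_cnj_iff of_real_Re)
  qed
  have "map_poly complex_of_real (\<Prod>e\<leftarrow>map Re as. [:- e, 1:]) = (\<Prod>a\<leftarrow>as. [:- a, 1:])"
    using re by (induction as) (simp_all add: hp.hom_mult del: mult_pCons_left mult_pCons_right)
  also have "\<dots> = map_poly complex_of_real (char_poly A)"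
    using comm_ring_hom.char_poly_hom[OF hc A] as(1) by (simp add: C_def)
  finally have "char_poly A = (\<Prod>e\<leftarrow>map Re as. [:- e, 1:])"
    by simp
  then show thesis using that as(2) by (metis length_map)
qed

lemma length_eigenvalues_desc_adjacency_mat:
  assumes "pair_graph G"
  shows "length (eigenvalues_desc (adjacency_mat vs G)) = length vs"
proof -
  interpret pair_graph G by fact
  have "sym (parcs G)"
    using pair_sym_arcs by (simp add: symmetric_def)
  then have "adjacency_mat vs G $$ (i, j) = adjacency_mat vs G $$ (j, i)"
    if "i < length vs" "j < length vs" for i j
    using that by (auto simp: adjacency_mat_def dest: symD)
  moreover have "adjacency_mat vs G \<in> carrier_mat (length vs) (length vs)"
    by (simp add: adjacency_mat_def)
  ultimately obtain es where es: "char_poly (adjacency_mat vs G) = (\<Prod>e\<leftarrow>es. [:- e, 1:])"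
      "length es = length vs"
    using real_symmetric_char_poly_splits by metis
  have "proots (\<Prod>e\<leftarrow>es. [:- e, 1:]) = mset es"
  proof (induction es)
    case (Cons e es)
    have "(\<Prod>e\<leftarrow>es. [:- e, 1:]) \<noteq> 0" by (auto simp: prod_list_zero_iff)
    moreover have "proots [:- e, 1:] = {#e#}" by (simp add: proots_linear_factor)
    ultimately show ?case
      using Cons by (simp add: proots_mult del: mult_pCons_left mult_pCons_right)
  qed simp
  then have "size (proots (char_poly (adjacency_mat vs G))) = length vs"
    using es by simp
  then show ?thesis
    by (metis eigenvalues_desc_def length_rev mset_sorted_list_of_multiset size_mset)
qed
end

theory Submission
  imports Defs
begin

text \<open>
  Put \<open>k = s - 1\<close> and let \<open>A\<close>, \<open>B\<close> be the adjacency matrices of the graph and its complement, so that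
  \<open>A + B = J - I\<close>, where \<open>J\<close> is the all-ones matrix. On the orthogonal complement of the all-ones
  vector the form of \<open>J - I\<close> is \<open>-1\<close>, whence Weyl's argument gives \<open>\<mu>\<^sub>s(A) + \<mu>\<^bsub>n-s+2\<^esub>(B) \<le> -1\<close>
  and the same with \<open>A\<close> and \<open>B\<close> exchanged. A large \<open>s\<close>-th eigenvalue on one side thus
  forces \<open>k\<close> very negative eigenvalues on the other side. Together with
  \<open>\<mu>\<^sub>1(A) + \<mu>\<^sub>1(B) \<ge> n - 1\<close> and the fact that the squares of all \<open>2n\<close> eigenvalues sum to
  \<open>n(n - 1)\<close>, this bounds \<open>(|\<mu>\<^sub>s(A)| + |\<mu>\<^sub>s(B)| + 1)\<^sup>2\<close> by \<open>n\<^sup>2 / (2k)\<close> when both eigenvalues are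
  nonnegative. If one of them is negative, then \<open>n - k\<close> eigenvalues lie below it, which
  makes it small enough to be absorbed because \<open>n \<ge> 15k\<close>.
\<close>

section \<open>Orthogonal diagonalisation of real symmetric matrices\<close>

text \<open>If \<open>v\<close> is already the first unit vector then \<open>c = 1 / 0 = 0\<close> and \<open>W\<close> is the identity, as needed.\<close>

lemma householder_reflection:
  fixes v :: "real vec"
  assumes v: "v \<in> carrier_vec n" and norm: "v \<bullet> v = 1" and n: "0 < n"
  obtains W where "W \<in> carrier_mat n n" "transpose_mat W = W" "W * W = 1\<^sub>m n"
    "W *\<^sub>v unit_vec n 0 = v"
proof -
  define u where "u i = v $ i - (if i = 0 then 1 else 0)" for i
  \<comment> \<open>With \<open>u\<close> = v - e_0, where e_0 is the first unit vector, |v| = 1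
    gives |u|^2 = 2(1 - v_0). So \<open>c\<close> is the Householder factor 2 / |u|^2, and the
    reflection \<open>W\<close> along \<open>u\<close> swaps e_0 and \<open>v\<close>.\<close>
  define c where "c = 1 / (1 - v $ 0)"
  define W where "W = mat n n (\<lambda>(i, j). (if i = j then 1 else 0) - c * u i * u j)"
  have vv: "(\<Sum>i<n. v $ i * v $ i) = 1"
    using norm v by (simp add: scalar_prod_def lessThan_atLeast0)
  have "(\<Sum>i<n. u i * u i) = (\<Sum>i<n. v $ i * v $ i + (if i = 0 then 1 - 2 * v $ 0 else 0))"
    by (rule sum.cong) (auto simp: u_def algebra_simps)
  also have "\<dots> = 2 * (1 - v $ 0)"
    using n by (simp add: sum.distrib vv)
  finally have uu: "(\<Sum>i<n. u i * u i) = 2 * (1 - v $ 0)" .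
  \<comment> \<open>Since u_0 = v_0 - 1, the factor \<open>c * u 0\<close> is -1 unless v_0 = 1; in
    that case |u|^2 = 0 forces every \<open>u i\<close> to vanish.\<close>
  have cu: "c * u 0 * u i = - u i" if "i < n" for i
  proof (cases "v $ 0 = 1")
    case True
    then have "(\<Sum>i<n. u i * u i) = 0" using uu by simp
    then have "u i = 0" using that by (subst (asm) sum_nonneg_eq_0_iff) auto
    then show ?thesis by simp
  next
    case False
    then have "c * u 0 = -1" by (simp add: c_def u_def field_simps)
    then show ?thesis by simp
  qed
  have cc: "c * c * (2 * (1 - v $ 0)) = 2 * c"
  proof (cases "v $ 0 = 1")
    case False
    then have "c * (1 - v $ 0) = 1" by (simp add: c_def)
    then show ?thesis by (metis mult.assoc mult.commute mult_1)
  qed (simp add: c_def)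
  have W: "W \<in> carrier_mat n n" by (simp add: W_def)
  have WW: "W * W = 1\<^sub>m n"
  proof (intro eq_matI)
    fix i j assume "i < dim_row (1\<^sub>m n :: real mat)" "j < dim_col (1\<^sub>m n :: real mat)"
    then have ij: "i < n" "j < n" by auto
    have "(W * W) $$ (i, j) = (\<Sum>k<n. ((if i = k then 1 else 0) - c * u i * u k)
        * ((if k = j then 1 else 0) - c * u k * u j))"
      using ij by (simp add: W_def scalar_prod_def lessThan_atLeast0)
    also have "\<dots> = (\<Sum>k<n. (if k = i then (if i = j then 1 else 0) - c * u i * u j else 0)
        - (if k = j then c * u i * u j else 0) + c * c * u i * u j * (u k * u k))"
      by (rule sum.cong) (auto simp: algebra_simps)
    also have "\<dots> = ((if i = j then 1 else 0) - c * u i * u j) - c * u i * u j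
        + c * c * u i * u j * (2 * (1 - v $ 0))"
      using ij by (simp only: sum.distrib sum_subtractf sum_distrib_left[symmetric] uu) simp
    also have "\<dots> = (if i = j then 1 else 0) - 2 * c * u i * u j
        + (c * c * (2 * (1 - v $ 0))) * (u i * u j)"
      by (simp add: algebra_simps)
    also have "\<dots> = 1\<^sub>m n $$ (i, j)"
      unfolding cc using ij by simp
    finally show "(W * W) $$ (i, j) = 1\<^sub>m n $$ (i, j)" .
  qed (auto simp: W_def)
  have "W *\<^sub>v unit_vec n 0 = v"
  proof (intro eq_vecI)
    fix i assume "i < dim_vec v"
    then have i: "i < n" using v by simp
    have "(W *\<^sub>v unit_vec n 0) $ i = (if i = 0 then 1 else 0) - c * u 0 * u i"
      using i n by (simp add: W_def mult_ac)
    then show "(W *\<^sub>v unit_vec n 0) $ i = v $ i"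
      unfolding cu[OF i] by (simp add: u_def)
  qed (use v in \<open>simp add: W_def\<close>)
  moreover have "transpose_mat W = W"
    by (rule eq_matI) (auto simp: W_def)
  ultimately show thesis using that W WW by blast
qed

text \<open>Deflation: a Householder reflection turns a unit eigenvector for \<open>e\<close> into
  the first unit vector, which splits off a 1 x 1 block. The remaining block \<open>C\<close> is
  symmetric, and cancelling one linear factor gives its characteristic polynomial, so the induction
  applies. The diagonal follows the order of \<open>es\<close>, whichever order is supplied.\<close>

lemma symmetric_mat_orthogonal_diag:
  fixes A :: "real mat"
  assumes "A \<in> carrier_mat n n" "transpose_mat A = A"
    and "char_poly A = (\<Prod>e\<leftarrow>es. [:- e, 1:])"
  shows "\<exists>U \<in> carrier_mat n n. U * transpose_mat U = 1\<^sub>m n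
    \<and> A = U * mat_diag n (\<lambda>i. es ! i) * transpose_mat U"
  using assms
proof (induction es arbitrary: n A)
  case Nil
  then have "n = 0" using degree_monic_char_poly[of A n] by auto
  then show ?case using Nil by (intro bexI[of _ "1\<^sub>m 0"]) auto
next
  case (Cons e es)
  note A = Cons.prems(1) and sym = Cons.prems(2)
  have cp: "char_poly A = [:- e, 1:] * (\<Prod>e\<leftarrow>es. [:- e, 1:])"
    using Cons.prems(3) by simp
  then have "poly (char_poly A) e = 0" by simp
  then obtain w where w: "w \<in> carrier_vec n" "w \<noteq> 0\<^sub>v n" "A *\<^sub>v w = e \<cdot>\<^sub>v w"
    using eigenvalue_root_char_poly[OF A] A unfolding eigenvalue_def eigenvector_def by auto
  then obtain m where n: "n = Suc m" by (cases n) auto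
  have ww: "w \<bullet> w > 0"
  proof -
    obtain i where "i < n" "w $ i \<noteq> 0"
      using w by (metis eq_vecI carrier_vecD index_zero_vec)
    then have "(\<Sum>i<n. w $ i * w $ i) > 0"
      by (intro sum_pos2[of _ i]) (auto simp: zero_less_mult_iff)
    then show ?thesis using w by (simp add: scalar_prod_def lessThan_atLeast0)
  qed
  define v where "v = (1 / sqrt (w \<bullet> w)) \<cdot>\<^sub>v w"
  have v: "v \<in> carrier_vec n" using w by (simp add: v_def)
  have Av: "A *\<^sub>v v = e \<cdot>\<^sub>v v"
    using w A by (simp add: v_def smult_smult_assoc mult.commute mult_mat_vec)
  have "v \<bullet> v = 1"
    using w ww by (simp add: v_def field_simps)
  then obtain W where W: "W \<in> carrier_mat n n" "transpose_mat W = W" "W * W = 1\<^sub>m n"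
    and We: "W *\<^sub>v unit_vec n 0 = v"
    using householder_reflection[OF v] n by auto
  define B where "B = W * A * W"
  have B: "B \<in> carrier_mat n n" using W A by (simp add: B_def)
  have symB: "transpose_mat B = B"
    using W A sym by (simp add: B_def transpose_mult[of _ n n _ n])
  have ABW: "A = W * B * W"
  proof -
    have "W * B * W = (W * W) * A * (W * W)"
      unfolding B_def using W(1) A by (simp add: assoc_mult_mat[of _ n n _ n _ n])
    also have "\<dots> = A" unfolding W(3) using A by simp
    finally show ?thesis by simp
  qed
  have "B *\<^sub>v unit_vec n 0 = W *\<^sub>v (A *\<^sub>v (W *\<^sub>v unit_vec n 0))"
    using W A by (simp add: B_def assoc_mult_mat_vec[of _ n n _ n])
  also have "\<dots> = e \<cdot>\<^sub>v (W *\<^sub>v v)"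
    using W v by (simp add: We Av mult_mat_vec)
  also have "W *\<^sub>v v = (W * W) *\<^sub>v unit_vec n 0"
    unfolding We[symmetric] using W(1) by (simp add: assoc_mult_mat_vec[of _ n n _ n])
  finally have Be: "B *\<^sub>v unit_vec n 0 = e \<cdot>\<^sub>v unit_vec n 0"
    unfolding W(3) by simp
  have B0: "B $$ (i, 0) = (if i = 0 then e else 0)" if "i < n" for i
    using arg_cong[OF Be, of "\<lambda>x. x $ i"] that B n by simp
  have B0': "B $$ (0, i) = (if i = 0 then e else 0)" if "i < n" for i
    using arg_cong[OF symB, of "\<lambda>M. M $$ (i, 0)"] that B n B0 by simp
  define C where "C = mat m m (\<lambda>(i, j). B $$ (Suc i, Suc j))"
  define E where "E = mat 1 1 (\<lambda>_. e)"
  have C: "C \<in> carrier_mat m m" and E: "E \<in> carrier_mat 1 1" by (auto simp: C_def E_def)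
  \<comment> \<open>The eigenvector equation clears the first column below \<open>e\<close>;
    symmetry then clears the first row.\<close>
  have blk: "B = four_block_mat E (0\<^sub>m 1 m) (0\<^sub>m m 1) C"
    using B B0 B0' n by (intro eq_matI) (auto simp: C_def E_def)
  have "similar_mat A B"
    using W A B ABW by (intro similar_matI[where n = n and P = W and Q = W]) auto
  then have "char_poly A = char_poly E * char_poly C"
    using char_poly_four_block_zeros_col[OF E _ C, of "0\<^sub>m 1 m"] blk by (simp add: char_poly_similar)
  moreover have "char_poly E = [:- e, 1:]"
    by (simp add: E_def char_poly_defs det_def)
  ultimately have "[:- e, 1:] * char_poly C = [:- e, 1:] * (\<Prod>e\<leftarrow>es. [:- e, 1:])"
    using cp by simp
  then have "char_poly C = (\<Prod>e\<leftarrow>es. [:- e, 1:])"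
    by (subst (asm) mult_left_cancel) auto
  moreover have "transpose_mat C = C"
  proof (rule eq_matI)
    fix i j assume "i < dim_row C" "j < dim_col C"
    then show "transpose_mat C $$ (i, j) = C $$ (i, j)"
      using arg_cong[OF symB, of "\<lambda>M. M $$ (Suc i, Suc j)"] B n by (simp add: C_def)
  qed (auto simp: C_def)
  ultimately obtain V where V: "V \<in> carrier_mat m m" "V * transpose_mat V = 1\<^sub>m m"
    "C = V * mat_diag m (\<lambda>i. es ! i) * transpose_mat V"
    using Cons.IH[OF C] by blast
  define X where "X = four_block_mat (1\<^sub>m 1) (0\<^sub>m 1 m) (0\<^sub>m m 1) V"
  have X: "X \<in> carrier_mat n n" using V n by (auto simp: X_def)
  have Xt: "transpose_mat X = four_block_mat (1\<^sub>m 1) (0\<^sub>m 1 m) (0\<^sub>m m 1) (transpose_mat V)"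
    unfolding X_def using V by (subst transpose_four_block_mat) auto
  have blk_mult: "four_block_mat P (0\<^sub>m 1 m) (0\<^sub>m m 1) Q * four_block_mat P' (0\<^sub>m 1 m) (0\<^sub>m m 1) Q'
      = four_block_mat (P * P') (0\<^sub>m 1 m) (0\<^sub>m m 1) (Q * Q')"
    if "P \<in> carrier_mat 1 1" "P' \<in> carrier_mat 1 1" "Q \<in> carrier_mat m m" "Q' \<in> carrier_mat m m"
    for P P' Q Q' :: "real mat"
    using that by (subst mult_four_block_mat[of _ 1 1 _ m _ m _ _ 1 _ m]) auto
  have XX: "X * transpose_mat X = 1\<^sub>m n"
    unfolding Xt unfolding X_def using V by (simp add: blk_mult n plus_1_eq_Suc del: One_nat_def)
  have D: "mat_diag n (\<lambda>i. (e # es) ! i)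
      = four_block_mat E (0\<^sub>m 1 m) (0\<^sub>m m 1) (mat_diag m (\<lambda>i. es ! i))"
    using n by (intro eq_matI) (auto simp: mat_diag_def E_def nth_Cons')
  have XB: "B = X * mat_diag n (\<lambda>i. (e # es) ! i) * transpose_mat X"
    unfolding Xt unfolding X_def D blk using V E by (simp add: blk_mult del: One_nat_def)
  let ?U = "W * X"
  have Ut: "transpose_mat ?U = transpose_mat X * W"
    using W X by (simp add: transpose_mult[of _ n n _ n])
  have conj_assoc: "W * (X * M * transpose_mat X) * W = W * X * M * (transpose_mat X * W)"
    if "M \<in> carrier_mat n n" for M
    using that W(1) X by (simp add: assoc_mult_mat[of _ n n _ n _ n])
  have "?U * transpose_mat ?U = W * (X * transpose_mat X) * W"
    unfolding Ut using W X by (simp add: assoc_mult_mat[of _ n n _ n _ n])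
  then have "?U * transpose_mat ?U = 1\<^sub>m n" using XX W by simp
  moreover have "A = ?U * mat_diag n (\<lambda>i. (e # es) ! i) * transpose_mat ?U"
    unfolding Ut unfolding ABW unfolding XB by (rule conj_assoc) simp
  ultimately show ?case using W X by (intro bexI[of _ ?U]) auto
qed

section \<open>Diagonalisation with the eigenvalues in descending order\<close>

lemma proots_prod_list_linear:
  fixes es :: "real list"
  shows "proots (\<Prod>e\<leftarrow>es. [:- e, 1:]) = mset es"
proof (induction es)
  case (Cons e es)
  have "(\<Prod>e\<leftarrow>es. [:- e, 1:]) \<noteq> 0" by (auto simp: prod_list_zero_iff)
  then show ?case
    using Cons by (simp add: proots_mult proots_linear_factor del: mult_pCons_left mult_pCons_right)
qed simp

text \<open>All roots are real, and a product of linear factors depends only on the multiset of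
  roots. Hence the sorted list can replace an arbitrary enumeration of them.\<close>

lemma symmetric_mat_eigenvalues_desc:
  fixes A :: "real mat"
  assumes A: "A \<in> carrier_mat n n" and sym: "transpose_mat A = A"
  shows "length (eigenvalues_desc A) = n"
    and "char_poly A = (\<Prod>e\<leftarrow>eigenvalues_desc A. [:- e, 1:])"
proof -
  have "A $$ (i, j) = A $$ (j, i)" if "i < n" "j < n" for i j
    using arg_cong[OF sym, of "\<lambda>M. M $$ (i, j)"] A that by simp
  then obtain es where es: "char_poly A = (\<Prod>e\<leftarrow>es. [:- e, 1:])" "length es = n"
    using real_symmetric_char_poly_splits[OF A] by metis
  have m: "mset (eigenvalues_desc A) = mset es"
    by (simp add: eigenvalues_desc_def es proots_prod_list_linear)
  then show "length (eigenvalues_desc A) = n"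
    using es(2) by (metis size_mset)
  have "(\<Prod>e\<leftarrow>xs. [:- e, 1:]) = (\<Prod>e\<in>#mset xs. [:- e, 1:])" for xs :: "real list"
    by (simp flip: prod_mset_prod_list)
  then show "char_poly A = (\<Prod>e\<leftarrow>eigenvalues_desc A. [:- e, 1:])"
    using es(1) m by metis
qed

lemma eigenvalues_desc_antimono:
  assumes "k \<le> l" "l < length (eigenvalues_desc A)"
  shows "eigenvalues_desc A ! l \<le> eigenvalues_desc A ! k"
proof -
  have "sorted (rev (eigenvalues_desc A))"
    by (simp add: eigenvalues_desc_def)
  then show ?thesis
    using sorted_rev_nth_mono assms by blast
qed

lemma sum_swap3:
  "(\<Sum>k\<in>A. \<Sum>i\<in>B. \<Sum>j\<in>C. f k i j) = (\<Sum>i\<in>B. \<Sum>j\<in>C. \<Sum>k\<in>A. f k i j)"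
  by (rule trans[OF sum.swap sum.cong[OF refl sum.swap]])

text \<open>The vector \<open>u k\<close> has coordinates \<open>u k i\<close> and belongs to the
  eigenvalue at position \<open>k\<close> of the descending list. The clauses are orthonormality,
  the resolution of the identity (which yields Parseval) and the spectral decomposition of
  \<open>A\<close>.\<close>

definition orthonormal_eigenbasis :: "nat \<Rightarrow> real mat \<Rightarrow> (nat \<Rightarrow> nat \<Rightarrow> real) \<Rightarrow> bool" where
  "orthonormal_eigenbasis n A u \<longleftrightarrow>
     (\<forall>k<n. \<forall>l<n. (\<Sum>i<n. u k i * u l i) = (if k = l then 1 else 0)) \<and>
     (\<forall>i<n. \<forall>j<n. (\<Sum>k<n. u k i * u k j) = (if i = j then 1 else 0)) \<and>
     (\<forall>i<n. \<forall>j<n. A $$ (i, j) = (\<Sum>k<n. eigenvalues_desc A ! k * u k i * u k j))"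

lemma ex_orthonormal_eigenbasis:
  fixes A :: "real mat"
  assumes A: "A \<in> carrier_mat n n" and sym: "transpose_mat A = A"
  shows "\<exists>u. orthonormal_eigenbasis n A u"
proof -
  define e where "e k = eigenvalues_desc A ! k" for k
  obtain U where U: "U \<in> carrier_mat n n" "U * transpose_mat U = 1\<^sub>m n"
    "A = U * mat_diag n e * transpose_mat U"
    using symmetric_mat_orthogonal_diag[OF A sym symmetric_mat_eigenvalues_desc(2)[OF A sym]]
    unfolding e_def by blast
  have U': "transpose_mat U * U = 1\<^sub>m n"
    using mat_mult_left_right_inverse[OF U(1) _ U(2)] U(1) by simp
  define u where "u k i = U $$ (i, k)" for k i
  have "(\<Sum>k<n. u k i * u k j) = (if i = j then 1 else 0)" if "i < n" "j < n" for i j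
    using arg_cong[OF U(2), of "\<lambda>M. M $$ (i, j)"] that U(1)
    by (simp add: u_def scalar_prod_def lessThan_atLeast0)
  moreover have "(\<Sum>i<n. u k i * u l i) = (if k = l then 1 else 0)" if "k < n" "l < n" for k l
    using arg_cong[OF U', of "\<lambda>M. M $$ (k, l)"] that U(1)
    by (simp add: u_def scalar_prod_def lessThan_atLeast0)
  moreover have "A $$ (i, j) = (\<Sum>k<n. e k * u k i * u k j)" if "i < n" "j < n" for i j
    using that U(1) unfolding U(3) mat_diag_mult_right[OF U(1)]
    by (simp add: u_def scalar_prod_def lessThan_atLeast0 mult.commute mult.left_commute)
  ultimately have "orthonormal_eigenbasis n A u"
    by (auto simp: orthonormal_eigenbasis_def e_def)
  then show ?thesis by blast
qed

section \<open>Quadratic forms, norms and traces in an eigenbasis\<close>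

lemma square_of_linear_form:
  fixes u x :: "nat \<Rightarrow> real"
  shows "(\<Sum>i<n. u i * x i)\<^sup>2 = (\<Sum>i<n. \<Sum>j<n. u i * u j * x i * x j)"
  by (simp add: power2_eq_square sum_product mult_ac)

lemma orthonormal_eigenbasis_quadratic_form:
  assumes "orthonormal_eigenbasis n A u"
  shows "(\<Sum>i<n. \<Sum>j<n. A $$ (i, j) * x i * x j)
    = (\<Sum>k<n. eigenvalues_desc A ! k * (\<Sum>i<n. u k i * x i)\<^sup>2)"
proof -
  have "(\<Sum>k<n. eigenvalues_desc A ! k * (\<Sum>i<n. u k i * x i)\<^sup>2)
      = (\<Sum>k<n. \<Sum>i<n. \<Sum>j<n. eigenvalues_desc A ! k * u k i * u k j * x i * x j)"
    unfolding square_of_linear_form sum_distrib_left by (simp add: mult.assoc)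
  also have "\<dots> = (\<Sum>i<n. \<Sum>j<n. \<Sum>k<n. eigenvalues_desc A ! k * u k i * u k j * x i * x j)"
    by (rule sum_swap3)
  also have "\<dots> = (\<Sum>i<n. \<Sum>j<n. A $$ (i, j) * x i * x j)"
    using assms by (intro sum.cong refl) (simp add: orthonormal_eigenbasis_def sum_distrib_right)
  finally show ?thesis by simp
qed

lemma orthonormal_eigenbasis_parseval:
  assumes "orthonormal_eigenbasis n A u"
  shows "(\<Sum>i<n. (x i)\<^sup>2) = (\<Sum>k<n. (\<Sum>i<n. u k i * x i)\<^sup>2)"
proof -
  have "(\<Sum>k<n. (\<Sum>i<n. u k i * x i)\<^sup>2) = (\<Sum>i<n. \<Sum>j<n. \<Sum>k<n. u k i * u k j * x i * x j)"
    unfolding square_of_linear_form by (rule sum_swap3)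
  also have "\<dots> = (\<Sum>i<n. \<Sum>j<n. if j = i then (x i)\<^sup>2 else 0)"
  proof (intro sum.cong refl)
    fix i j assume "i \<in> {..<n}" "j \<in> {..<n}"
    then have "(\<Sum>k<n. u k i * u k j) = (if i = j then 1 else 0)"
      using assms by (simp add: orthonormal_eigenbasis_def)
    then show "(\<Sum>k<n. u k i * u k j * x i * x j) = (if j = i then (x i)\<^sup>2 else 0)"
      by (simp add: power2_eq_square flip: sum_distrib_right)
  qed
  finally show ?thesis by simp
qed

text \<open>Both sides are the trace of A^2. Squaring the spectral decomposition entrywise and
  summing over the entries first, orthonormality removes all terms with k different from l.\<close>

lemma sum_square_eigenvalues_desc:
  fixes A :: "real mat"
  assumes A: "A \<in> carrier_mat n n" "transpose_mat A = A"
  shows "(\<Sum>k<n. (eigenvalues_desc A ! k)\<^sup>2) = (\<Sum>i<n. \<Sum>j<n. (A $$ (i, j))\<^sup>2)"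
proof -
  let ?e = "\<lambda>k. eigenvalues_desc A ! k"
  obtain u where u: "orthonormal_eigenbasis n A u"
    using ex_orthonormal_eigenbasis[OF A] by blast
  have "(A $$ (i, j))\<^sup>2 = (\<Sum>k<n. \<Sum>l<n. (?e k * ?e l) * ((u k i * u l i) * (u k j * u l j)))"
    if "i < n" "j < n" for i j
  proof -
    have "A $$ (i, j) = (\<Sum>k<n. ?e k * u k i * u k j)"
      using u that by (simp add: orthonormal_eigenbasis_def)
    then show ?thesis by (simp only: power2_eq_square sum_product mult_ac)
  qed
  then have "(\<Sum>i<n. \<Sum>j<n. (A $$ (i, j))\<^sup>2)
      = (\<Sum>i<n. \<Sum>j<n. \<Sum>k<n. \<Sum>l<n. (?e k * ?e l) * ((u k i * u l i) * (u k j * u l j)))"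
    by simp
  also have "\<dots> = (\<Sum>k<n. \<Sum>l<n. \<Sum>i<n. \<Sum>j<n. (?e k * ?e l) * ((u k i * u l i) * (u k j * u l j)))"
    \<comment> \<open>First \<open>j\<close>, then \<open>i\<close>, is moved inside the pair
      \<open>k\<close>, \<open>l\<close>.\<close>
    by (rule trans[OF sum.cong[OF refl sum_swap3] sum_swap3])
  also have "\<dots> = (\<Sum>k<n. \<Sum>l<n. if l = k then (?e k)\<^sup>2 else 0)"
  proof (intro sum.cong refl)
    fix k l assume kl: "k \<in> {..<n}" "l \<in> {..<n}"
    have "(\<Sum>i<n. \<Sum>j<n. (?e k * ?e l) * ((u k i * u l i) * (u k j * u l j)))
        = (?e k * ?e l) * ((\<Sum>i<n. u k i * u l i) * (\<Sum>j<n. u k j * u l j))"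
      unfolding sum_product unfolding sum_distrib_left ..
    also have "(\<Sum>i<n. u k i * u l i) = (if k = l then 1 else 0)"
      using u kl by (simp add: orthonormal_eigenbasis_def)
    finally show "(\<Sum>i<n. \<Sum>j<n. (?e k * ?e l) * ((u k i * u l i) * (u k j * u l j)))
        = (if l = k then (?e k)\<^sup>2 else 0)"
      by (simp add: power2_eq_square)
  qed
  finally show ?thesis by simp
qed

section \<open>Eigenvalue inequalities\<close>

text \<open>Fewer than n equations, padded with zero rows, form a singular n x n matrix, which has a
  nonzero kernel vector. A positive sum of squares expresses that \<open>x\<close> is nonzero on the
  coordinates below n.\<close>

lemma finite_homogeneous_system_nontrivial:
  fixes F :: "(nat \<Rightarrow> real) set"
  assumes "finite F" "card F < n"
  shows "\<exists>x :: nat \<Rightarrow> real. (\<Sum>i<n. (x i)\<^sup>2) > 0 \<and> (\<forall>f\<in>F. (\<Sum>i<n. f i * x i) = 0)"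
proof -
  obtain fs where fs: "set fs = F" "length fs = card F"
    using assms(1) finite_distinct_list distinct_card by metis
  define M where "M = mat n n (\<lambda>(t, i). if t < length fs then (fs ! t) i else 0)"
  have M: "M \<in> carrier_mat n n" by (simp add: M_def)
  \<comment> \<open>Row n - 1 of \<open>M\<close> is padding, because F has fewer than n
    elements.\<close>
  have "transpose_mat M *\<^sub>v unit_vec n (n - 1) = 0\<^sub>v n"
    using assms(2) fs(2) by (intro eq_vecI) (auto simp: M_def)
  moreover have "unit_vec n (n - 1) \<noteq> (0\<^sub>v n :: real vec)"
    using assms(2) by simp
  moreover have "unit_vec n (n - 1) \<in> carrier_vec n" by simp
  moreover have "transpose_mat M \<in> carrier_mat n n" using M by simp
  ultimately have "det (transpose_mat M) = 0"
    using det_0_iff_vec_prod_zero by blast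
  then obtain v where v: "v \<in> carrier_vec n" "v \<noteq> 0\<^sub>v n" "M *\<^sub>v v = 0\<^sub>v n"
    using det_0_iff_vec_prod_zero[OF M] det_transpose[OF M] by auto
  obtain i where "i < n" "v $ i \<noteq> 0"
    using v by (metis eq_vecI carrier_vecD index_zero_vec)
  then have "(\<Sum>i<n. (v $ i)\<^sup>2) > 0"
    by (intro sum_pos2[of _ i]) auto
  moreover have "(\<Sum>i<n. f i * v $ i) = 0" if "f \<in> F" for f
  proof -
    have "f \<in> set fs" using that fs(1) by simp
    then have "\<exists>t. t < length fs \<and> fs ! t = f" by (simp only: in_set_conv_nth)
    then obtain t where t: "t < length fs \<and> fs ! t = f" by (rule exE)
    moreover have "t < n" using t fs(2) assms(2) by linarith
    ultimately show ?thesis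
      using arg_cong[OF v(3), of "\<lambda>w. w $ t"] v(1) t
      by (simp add: M_def scalar_prod_def lessThan_atLeast0)
  qed
  ultimately show ?thesis by (intro exI[of _ "\<lambda>i. v $ i"]) simp
qed

text \<open>Only indices with a nonzero coefficient need \<open>e\<close> bounded below. A vector
  orthogonal to the eigenvectors of all later eigenvalues therefore has Rayleigh quotient at least
  \<open>t\<close>.\<close>

lemma quadratic_form_ge:
  fixes c e :: "nat \<Rightarrow> real"
  assumes "\<And>i. i < n \<Longrightarrow> c i \<noteq> 0 \<Longrightarrow> t \<le> e i"
  shows "t * (\<Sum>i<n. (c i)\<^sup>2) \<le> (\<Sum>i<n. e i * (c i)\<^sup>2)"
  unfolding sum_distrib_left
proof (rule sum_mono)
  fix i assume "i \<in> {..<n}"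
  then show "t * (c i)\<^sup>2 \<le> e i * (c i)\<^sup>2"
    using assms[of i] by (cases "c i = 0") (auto intro: mult_right_mono)
qed

text \<open>Indices are 0-based: this is \<open>\<mu>\<^bsub>k+1\<^esub>(A) + \<mu>\<^bsub>n-k+1\<^esub>(B) \<le> -1\<close> in the 1-based convention.\<close>

lemma complementary_eigenvalues_add_le:
  fixes A B :: "real mat"
  assumes A: "A \<in> carrier_mat n n" "transpose_mat A = A"
    and B: "B \<in> carrier_mat n n" "transpose_mat B = B"
    and AB: "\<And>i j. i < n \<Longrightarrow> j < n \<Longrightarrow> A $$ (i, j) + B $$ (i, j) = (if i = j then 0 else 1)"
    and k: "0 < k" "k < n"
  shows "eigenvalues_desc A ! k + eigenvalues_desc B ! (n - k) \<le> -1"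
proof -
  let ?a = "\<lambda>i. eigenvalues_desc A ! i" and ?b = "\<lambda>i. eigenvalues_desc B ! i"
  obtain u where u: "orthonormal_eigenbasis n A u"
    using ex_orthonormal_eigenbasis[OF A] by blast
  obtain w where w: "orthonormal_eigenbasis n B w"
    using ex_orthonormal_eigenbasis[OF B] by blast
  \<comment> \<open>Only \<open>1 + (n - 1 - k) + (k - 1) = n - 1\<close> linear conditions, so some \<open>x \<noteq> 0\<close> satisfies all of them.\<close>
  define F where "F = insert (\<lambda>_. 1) (u ` {k<..<n} \<union> w ` {n - k<..<n})"
  have "card F \<le> Suc (card (u ` {k<..<n} \<union> w ` {n - k<..<n}))"
    unfolding F_def by (rule card_insert_le_m1) auto
  also have "\<dots> \<le> Suc (card (u ` {k<..<n}) + card (w ` {n - k<..<n}))"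
    by (simp add: card_Un_le)
  also have "\<dots> \<le> Suc (card {k<..<n} + card {n - k<..<n})"
    using card_image_le[of "{k<..<n}" u] card_image_le[of "{n - k<..<n}" w] by simp
  also have "\<dots> < n" using k by simp
  finally have card: "card F < n" .
  have fin: "finite F" by (simp add: F_def)
  obtain x :: "nat \<Rightarrow> real" where x: "(\<Sum>i<n. (x i)\<^sup>2) > 0 \<and> (\<forall>f\<in>F. (\<Sum>i<n. f i * x i) = 0)"
    by (rule exE[OF finite_homogeneous_system_nontrivial[OF fin card]])
  note pos = conjunct1[OF x] and orth = bspec[OF conjunct2[OF x]]
  let ?N = "\<Sum>i<n. (x i)\<^sup>2"
  have "?a k * (\<Sum>i<n. (\<Sum>j<n. u i j * x j)\<^sup>2) \<le> (\<Sum>i<n. ?a i * (\<Sum>j<n. u i j * x j)\<^sup>2)"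
  proof (rule quadratic_form_ge[where c = "\<lambda>i. \<Sum>j<n. u i j * x j" and e = "?a"])
    fix i assume i: "i < n" "(\<Sum>j<n. u i j * x j) \<noteq> 0"
    have "u i \<in> F" if "k < i" using that i(1) unfolding F_def by simp
    then have "i \<le> k" using orth[of "u i"] i(2) by linarith
    then show "?a k \<le> ?a i"
      using k by (simp add: eigenvalues_desc_antimono symmetric_mat_eigenvalues_desc(1)[OF A])
  qed
  then have A_ge: "?a k * ?N \<le> (\<Sum>i<n. \<Sum>j<n. A $$ (i, j) * x i * x j)"
    by (simp only: orthonormal_eigenbasis_quadratic_form[OF u, of x] orthonormal_eigenbasis_parseval[OF u, of x])
  have "?b (n - k) * (\<Sum>i<n. (\<Sum>j<n. w i j * x j)\<^sup>2) \<le> (\<Sum>i<n. ?b i * (\<Sum>j<n. w i j * x j)\<^sup>2)"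
  proof (rule quadratic_form_ge[where c = "\<lambda>i. \<Sum>j<n. w i j * x j" and e = "?b"])
    fix i assume i: "i < n" "(\<Sum>j<n. w i j * x j) \<noteq> 0"
    have "w i \<in> F" if "n - k < i" using that i(1) unfolding F_def by simp
    then have "i \<le> n - k" using orth[of "w i"] i(2) by linarith
    then show "?b (n - k) \<le> ?b i"
      using k by (simp add: eigenvalues_desc_antimono symmetric_mat_eigenvalues_desc(1)[OF B])
  qed
  then have B_ge: "?b (n - k) * ?N \<le> (\<Sum>i<n. \<Sum>j<n. B $$ (i, j) * x i * x j)"
    by (simp only: orthonormal_eigenbasis_quadratic_form[OF w, of x] orthonormal_eigenbasis_parseval[OF w, of x])
  \<comment> \<open>The constant function 1 in \<open>F\<close> makes the coordinates of
    \<open>x\<close> sum to 0, so J contributes nothing and only the form of -I remains.\<close>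
  have "(\<Sum>i<n. \<Sum>j<n. A $$ (i, j) * x i * x j) + (\<Sum>i<n. \<Sum>j<n. B $$ (i, j) * x i * x j) = - ?N"
  proof -
    have "(\<Sum>i<n. \<Sum>j<n. A $$ (i, j) * x i * x j) + (\<Sum>i<n. \<Sum>j<n. B $$ (i, j) * x i * x j)
        = (\<Sum>i<n. \<Sum>j<n. (A $$ (i, j) + B $$ (i, j)) * x i * x j)"
      by (simp add: sum.distrib distrib_right)
    also have "\<dots> = (\<Sum>i<n. \<Sum>j<n. x i * x j - (if j = i then (x i)\<^sup>2 else 0))"
      by (intro sum.cong refl) (auto simp: AB power2_eq_square)
    also have "\<dots> = (\<Sum>i<n. x i) * (\<Sum>j<n. x j) - ?N"
      by (simp add: sum_subtractf sum_product)
    also have "(\<Sum>i<n. x i) = 0"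
      using orth[of "\<lambda>_. 1"] by (simp add: F_def)
    finally show ?thesis by simp
  qed
  with A_ge B_ge have "(?a k + ?b (n - k)) * ?N \<le> -1 * ?N"
    by (simp add: distrib_right)
  then show ?thesis using pos by (simp only: mult_le_cancel_right)
qed

text \<open>This is the Rayleigh bound at the all-ones vector, whose squared norm is n. The factors
  \<open>* 1\<close> keep the terms in the shape of the eigenbasis lemmas.\<close>

lemma entry_sum_le_top_eigenvalue:
  fixes A :: "real mat"
  assumes A: "A \<in> carrier_mat n n" "transpose_mat A = A"
  shows "(\<Sum>i<n. \<Sum>j<n. A $$ (i, j)) \<le> eigenvalues_desc A ! 0 * real n"
proof -
  let ?a = "\<lambda>i. eigenvalues_desc A ! i"
  obtain u where u: "orthonormal_eigenbasis n A u"
    using ex_orthonormal_eigenbasis[OF A] by blast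
  have "(\<Sum>k<n. ?a k * (\<Sum>i<n. u k i * 1)\<^sup>2) \<le> (\<Sum>k<n. ?a 0 * (\<Sum>i<n. u k i * 1)\<^sup>2)"
    by (intro sum_mono mult_right_mono)
      (simp_all add: eigenvalues_desc_antimono symmetric_mat_eigenvalues_desc(1)[OF A])
  also have "\<dots> = ?a 0 * (\<Sum>i<n. 1\<^sup>2)"
    unfolding orthonormal_eigenbasis_parseval[OF u, of "\<lambda>_. 1"] sum_distrib_left ..
  finally have "(\<Sum>i<n. \<Sum>j<n. A $$ (i, j) * 1 * 1) \<le> ?a 0 * (\<Sum>i<n. 1\<^sup>2)"
    unfolding orthonormal_eigenbasis_quadratic_form[OF u] .
  then show ?thesis by simp
qed

section \<open>The numerical estimate\<close>

text \<open>Index 0 is kept apart because the top eigenvalues of the two matrices are only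
  controlled jointly, through their sum.\<close>

lemma sum_squares_ge_on_parts:
  fixes a :: "nat \<Rightarrow> real"
  assumes "P \<subseteq> {1..<n}" "Q \<subseteq> {1..<n}" "P \<inter> Q = {}" "0 < n"
    and P: "\<And>i. i \<in> P \<Longrightarrow> p \<le> (a i)\<^sup>2" and Q: "\<And>i. i \<in> Q \<Longrightarrow> q \<le> (a i)\<^sup>2"
  shows "(a 0)\<^sup>2 + real (card P) * p + real (card Q) * q \<le> (\<Sum>i<n. (a i)\<^sup>2)"
proof -
  have fin: "finite P" "finite Q" using assms finite_subset by blast+
  have "real (card P) * p \<le> (\<Sum>i\<in>P. (a i)\<^sup>2)" "real (card Q) * q \<le> (\<Sum>i\<in>Q. (a i)\<^sup>2)"
    using P Q by (simp_all add: sum_bounded_below)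
  moreover have "(\<Sum>i\<in>insert 0 (P \<union> Q). (a i)\<^sup>2) = (a 0)\<^sup>2 + ((\<Sum>i\<in>P. (a i)\<^sup>2) + (\<Sum>i\<in>Q. (a i)\<^sup>2))"
  proof -
    have "0 \<notin> P \<union> Q" using assms by auto
    then show ?thesis using fin assms(3) by (simp add: sum.union_disjoint)
  qed
  moreover have "(\<Sum>i\<in>insert 0 (P \<union> Q). (a i)\<^sup>2) \<le> (\<Sum>i<n. (a i)\<^sup>2)"
    using assms by (intro sum_mono2) auto
  ultimately show ?thesis by linarith
qed

text \<open>The other hypotheses are symmetric under exchanging \<open>a\<close> and
  \<open>b\<close>, so \<open>le\<close> costs no generality and leaves three sign patterns. In each
  of them the aim is 2K(|a_k| + |b_k| + 1)^2 <= N^2, from which the claim follows by taking square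
  roots.\<close>

lemma complementary_spectra_bound:
  fixes a b :: "nat \<Rightarrow> real"
  assumes k: "1 \<le> k" and n: "15 * k \<le> n"
    and a: "\<And>i j. i \<le> j \<Longrightarrow> j < n \<Longrightarrow> a j \<le> a i"
    and b: "\<And>i j. i \<le> j \<Longrightarrow> j < n \<Longrightarrow> b j \<le> b i"
    and sq: "(\<Sum>i<n. (a i)\<^sup>2) + (\<Sum>i<n. (b i)\<^sup>2) = real n * (real n - 1)"
    and top: "real n - 1 \<le> a 0 + b 0"
    and ab: "a k + b (n - k) \<le> -1" and ba: "b k + a (n - k) \<le> -1"
    and le: "a k \<le> b k"
  shows "\<bar>a k\<bar> + \<bar>b k\<bar> \<le> real n / sqrt (2 * real k) - 1"
proof -
  define N K where "N = real n" and "K = real k"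
  have NK: "1 \<le> K" "15 * K \<le> N" using k n by (simp_all add: N_def K_def)
  have n0: "0 < n" and kn: "2 * k < n" using k n by auto
  have top_sq: "(N - 1)\<^sup>2 \<le> 2 * ((a 0)\<^sup>2 + (b 0)\<^sup>2)"
  proof -
    have "(N - 1)\<^sup>2 \<le> (a 0 + b 0)\<^sup>2"
      using top NK by (intro power_mono) (auto simp: N_def)
    moreover have "0 \<le> (a 0 - b 0)\<^sup>2" by simp
    ultimately show ?thesis by (simp add: power2_eq_square algebra_simps)
  qed
  have sq': "(\<Sum>i<n. (a i)\<^sup>2) + (\<Sum>i<n. (b i)\<^sup>2) = N * (N - 1)"
    using sq by (simp add: N_def)
  \<comment> \<open>This disposes of the situation where |a_k| + |b_k| + 1 is bounded by a small
    constant.\<close>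
  have K_le: "2 * K * c \<le> N\<^sup>2" if "c \<le> 5" for c
  proof -
    have "2 * K * c \<le> 2 * K * 5" using that NK by (intro mult_left_mono) auto
    also have "\<dots> \<le> N * 1" using NK by simp
    also have "\<dots> \<le> N * N" using NK by (intro mult_left_mono) auto
    finally show ?thesis by (simp add: power2_eq_square)
  qed
  have "2 * K * (\<bar>a k\<bar> + \<bar>b k\<bar> + 1)\<^sup>2 \<le> N\<^sup>2"
  proof (cases "0 \<le> a k")
    case True
    define x y where "x = a k" and "y = b k"
    have xy: "0 \<le> x" "0 \<le> y" using True le by (auto simp: x_def y_def)
    have "(a 0)\<^sup>2 + real (card {1..k}) * x\<^sup>2 + real (card {n - k..<n}) * (1 + y)\<^sup>2 \<le> (\<Sum>i<n. (a i)\<^sup>2)"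
    proof (rule sum_squares_ge_on_parts)
      fix i assume "i \<in> {1..k}"
      then show "x\<^sup>2 \<le> (a i)\<^sup>2" using a[of i k] kn xy by (intro power_mono) (auto simp: x_def)
    next
      fix i assume "i \<in> {n - k..<n}"
      then have "(1 + y) \<le> - a i" using a[of "n - k" i] ba by (auto simp: y_def)
      then have "(1 + y)\<^sup>2 \<le> (- a i)\<^sup>2" using xy by (intro power_mono) auto
      then show "(1 + y)\<^sup>2 \<le> (a i)\<^sup>2" by simp
    qed (use kn n0 in auto)
    moreover have "(b 0)\<^sup>2 + real (card {1..k}) * y\<^sup>2 + real (card {n - k..<n}) * (1 + x)\<^sup>2 \<le> (\<Sum>i<n. (b i)\<^sup>2)"
    proof (rule sum_squares_ge_on_parts)
      fix i assume "i \<in> {1..k}"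
      then show "y\<^sup>2 \<le> (b i)\<^sup>2" using b[of i k] kn xy by (intro power_mono) (auto simp: y_def)
    next
      fix i assume "i \<in> {n - k..<n}"
      then have "(1 + x) \<le> - b i" using b[of "n - k" i] ab by (auto simp: x_def)
      then have "(1 + x)\<^sup>2 \<le> (- b i)\<^sup>2" using xy by (intro power_mono) auto
      then show "(1 + x)\<^sup>2 \<le> (b i)\<^sup>2" by simp
    qed (use kn n0 in auto)
    \<comment> \<open>The sum of squares is doubled to match \<open>top_sq\<close>; what remains on
      the right is then 2N(N - 1) - (N - 1)^2 = N^2 - 1.\<close>
    ultimately have "2 * ((a 0)\<^sup>2 + (b 0)\<^sup>2) + 2 * (K * (x\<^sup>2 + (1 + y)\<^sup>2 + y\<^sup>2 + (1 + x)\<^sup>2)) \<le> 2 * (N * (N - 1))"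
      using sq' kn by (simp add: K_def distrib_left)
    then have "2 * K * (x\<^sup>2 + (1 + y)\<^sup>2 + y\<^sup>2 + (1 + x)\<^sup>2) \<le> N\<^sup>2"
      using top_sq by (simp add: power2_eq_square algebra_simps)
    moreover have "2 * K * (x + y + 1)\<^sup>2 \<le> 2 * K * (x\<^sup>2 + (1 + y)\<^sup>2 + y\<^sup>2 + (1 + x)\<^sup>2)"
    proof (rule mult_left_mono)
      \<comment> \<open>The right side of the goal exceeds the left by (x - y)^2 + 1.\<close>
      have "0 \<le> (x - y)\<^sup>2" by simp
      then show "(x + y + 1)\<^sup>2 \<le> x\<^sup>2 + (1 + y)\<^sup>2 + y\<^sup>2 + (1 + x)\<^sup>2"
        by (simp add: power2_eq_square algebra_simps)
    qed (use NK in simp)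
    ultimately show ?thesis using xy by (simp add: x_def y_def)
  next
    case neg: False
    define t where "t = - a k"
    have t: "0 < t" using neg by (simp add: t_def)
    show ?thesis
    proof (cases "0 \<le> b k")
      case True
      define y where "y = b k"
      have y: "0 \<le> y" using True by (simp add: y_def)
      \<comment> \<open>From index k on, all of \<open>a\<close> is at most -t; the last k values
        are even at most -(1 + y). The middle block has n - 2k >= 13k members, which is where the
        weight 13 below comes from.\<close>
      have "(a 0)\<^sup>2 + real (card {k..<n - k}) * t\<^sup>2 + real (card {n - k..<n}) * (1 + y)\<^sup>2 \<le> (\<Sum>i<n. (a i)\<^sup>2)"
      proof (rule sum_squares_ge_on_parts)
        fix i assume "i \<in> {k..<n - k}"
        then have "t \<le> - a i" using a[of k i] by (auto simp: t_def)
        then have "t\<^sup>2 \<le> (- a i)\<^sup>2" using t by (intro power_mono) auto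
        then show "t\<^sup>2 \<le> (a i)\<^sup>2" by simp
      next
        fix i assume "i \<in> {n - k..<n}"
        then have "(1 + y) \<le> - a i" using a[of "n - k" i] ba by (auto simp: y_def)
        then have "(1 + y)\<^sup>2 \<le> (- a i)\<^sup>2" using y by (intro power_mono) auto
        then show "(1 + y)\<^sup>2 \<le> (a i)\<^sup>2" by simp
      qed (use k kn n0 in auto)
      moreover have "(b 0)\<^sup>2 + real (card {1..k}) * y\<^sup>2 + real (card ({} :: nat set)) * 0 \<le> (\<Sum>i<n. (b i)\<^sup>2)"
      proof (rule sum_squares_ge_on_parts)
        fix i assume "i \<in> {1..k}"
        then show "y\<^sup>2 \<le> (b i)\<^sup>2" using b[of i k] kn y by (intro power_mono) (auto simp: y_def)
      qed (use kn n0 in auto)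
      moreover have "real (card {k..<n - k}) = N - 2 * K" using kn by (simp add: N_def K_def of_nat_diff)
      moreover have "13 * K * t\<^sup>2 \<le> (N - 2 * K) * t\<^sup>2"
        using NK by (intro mult_right_mono) auto
      ultimately have "2 * ((a 0)\<^sup>2 + (b 0)\<^sup>2) + 2 * (K * (13 * t\<^sup>2 + (1 + y)\<^sup>2 + y\<^sup>2)) \<le> 2 * (N * (N - 1))"
        using sq' kn by (simp add: K_def distrib_left)
      then have sum_le: "2 * K * (13 * t\<^sup>2 + (1 + y)\<^sup>2 + y\<^sup>2) \<le> N\<^sup>2"
        using top_sq by (simp add: power2_eq_square algebra_simps)
      have "2 * K * (t + y + 1)\<^sup>2 \<le> N\<^sup>2"
      \<comment> \<open>The bound 13t^2 + (1 + y)^2 + y^2 exceeds (t + y + 1)^2 by (y - t)^2 + (11t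
        - 2)t. This is clearly nonnegative for t >= 2/11. For smaller t and y >= 1, the first term
        is at least 81/121 while the second is greater than -44/121.\<close>
      proof (cases "2 / 11 \<le> t \<or> 1 \<le> y")
        case True
        have "0 \<le> (y - t)\<^sup>2 + (11 * t - 2) * t"
        proof (cases "2 / 11 \<le> t")
          case False
          with True have yt: "9 / 11 \<le> y - t" by simp
          then have "(9 / 11)\<^sup>2 \<le> (y - t)\<^sup>2" by (intro power_mono) auto
          then have "81 / 121 \<le> (y - t)\<^sup>2" by (simp add: power2_eq_square)
          moreover have "(11 * t - 2) * t = 11 * t\<^sup>2 - 2 * t"
            by (simp add: power2_eq_square algebra_simps)
          ultimately show ?thesis using False zero_le_power2[of t] by linarith
        qed (use t in simp)
        then have "(t + y + 1)\<^sup>2 \<le> 13 * t\<^sup>2 + (1 + y)\<^sup>2 + y\<^sup>2"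
          by (simp add: power2_eq_square algebra_simps)
        then have "2 * K * (t + y + 1)\<^sup>2 \<le> 2 * K * (13 * t\<^sup>2 + (1 + y)\<^sup>2 + y\<^sup>2)"
          using NK by (intro mult_left_mono) auto
        with sum_le show ?thesis by linarith
      next
        case False
        \<comment> \<open>Here t < 2/11 and y < 1, and (24/11)^2 = 576/121 is below the 5 allowed by
          \<open>K_le\<close>.\<close>
        then have "(t + y + 1)\<^sup>2 \<le> (24 / 11)\<^sup>2" using t y by (intro power_mono) auto
        then show ?thesis by (intro K_le) (simp add: power2_eq_square)
      qed
      then show ?thesis using t y by (simp add: t_def y_def)
    next
      case False
      define r where "r = - b k"
      have r: "0 < r" using False by (simp add: r_def)
      have "(a 0)\<^sup>2 + real (card {k..<n}) * t\<^sup>2 + real (card ({} :: nat set)) * 0 \<le> (\<Sum>i<n. (a i)\<^sup>2)"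
      proof (rule sum_squares_ge_on_parts)
        fix i assume "i \<in> {k..<n}"
        then have "t \<le> - a i" using a[of k i] by (auto simp: t_def)
        then have "t\<^sup>2 \<le> (- a i)\<^sup>2" using t by (intro power_mono) auto
        then show "t\<^sup>2 \<le> (a i)\<^sup>2" by simp
      qed (use k kn n0 in auto)
      moreover have "(b 0)\<^sup>2 + real (card {k..<n}) * r\<^sup>2 + real (card ({} :: nat set)) * 0 \<le> (\<Sum>i<n. (b i)\<^sup>2)"
      proof (rule sum_squares_ge_on_parts)
        fix i assume "i \<in> {k..<n}"
        then have "r \<le> - b i" using b[of k i] by (auto simp: r_def)
        then have "r\<^sup>2 \<le> (- b i)\<^sup>2" using r by (intro power_mono) auto
        then show "r\<^sup>2 \<le> (b i)\<^sup>2" by simp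
      qed (use k kn n0 in auto)
      moreover have "real (card {k..<n}) = N - K" using kn by (simp add: N_def K_def of_nat_diff)
      ultimately have "(a 0)\<^sup>2 + (b 0)\<^sup>2 + (N - K) * (t\<^sup>2 + r\<^sup>2) \<le> N * (N - 1)"
        using sq' by (simp add: distrib_left)
      \<comment> \<open>With both values negative, n - k squares on each side suffice, so the
        squares of the top eigenvalues are simply dropped.\<close>
      then have "(N - K) * (t\<^sup>2 + r\<^sup>2) \<le> N * (N - 1)"
        using zero_le_power2[of "a 0"] zero_le_power2[of "b 0"] by linarith
      moreover have "(N * (14 / 15)) * (t\<^sup>2 + r\<^sup>2) \<le> (N - K) * (t\<^sup>2 + r\<^sup>2)"
        using NK by (intro mult_right_mono) auto
      ultimately have "N * (14 / 15 * (t\<^sup>2 + r\<^sup>2)) \<le> N * (N - 1)"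
        unfolding mult.assoc by (rule order_trans[rotated])
      then have tr: "14 / 15 * (t\<^sup>2 + r\<^sup>2) \<le> N - 1"
        using NK by (subst (asm) mult_le_cancel_left_pos) auto
      \<comment> \<open>This is the exact defect in the Cauchy-Schwarz inequality for (t, r, 1) and
        (1, 1, 1).\<close>
      have "0 \<le> (t - r)\<^sup>2 + (t - 1)\<^sup>2 + (r - 1)\<^sup>2" by simp
      then have "(t + r + 1)\<^sup>2 \<le> 3 * (t\<^sup>2 + r\<^sup>2 + 1)"
        by (simp add: power2_eq_square algebra_simps)
      also have "\<dots> \<le> 45 / 14 * N" using tr by simp
      \<comment> \<open>Since K <= N/15, the resulting constant is (2/15)(45/14) = 3/7, which is
        below 1.\<close>
      finally have "2 * K * (t + r + 1)\<^sup>2 \<le> 2 / 15 * N * (45 / 14 * N)"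
        by (rule mult_mono[rotated]) (use NK in auto)
      also have "\<dots> \<le> N\<^sup>2" by (simp add: power2_eq_square)
      finally show ?thesis using t r by (simp add: t_def r_def)
    qed
  qed
  then have "(sqrt (2 * K) * (\<bar>a k\<bar> + \<bar>b k\<bar> + 1))\<^sup>2 \<le> N\<^sup>2"
    using NK by (simp add: power_mult_distrib)
  then have "sqrt (2 * K) * (\<bar>a k\<bar> + \<bar>b k\<bar> + 1) \<le> N"
    by (rule power2_le_imp_le) (use NK in simp)
  then have "\<bar>a k\<bar> + \<bar>b k\<bar> + 1 \<le> N / sqrt (2 * K)"
    using NK by (simp add: pos_le_divide_eq mult.commute)
  then show ?thesis by (simp add: N_def K_def)
qed

section \<open>Graphs\<close>

lemma adjacency_mat_carrier: "adjacency_mat vs G \<in> carrier_mat (length vs) (length vs)"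
  by (simp add: adjacency_mat_def)

lemma transpose_adjacency_mat:
  assumes "pair_graph G"
  shows "transpose_mat (adjacency_mat vs G) = adjacency_mat vs G"
proof -
  interpret pair_graph G by fact
  have "sym (parcs G)"
    using pair_sym_arcs by (simp add: symmetric_def)
  then show ?thesis
    by (intro eq_matI) (auto simp: adjacency_mat_def dest: symD)
qed

lemma adjacency_mat_add_complement:
  assumes "pair_graph G" "distinct vs" "set vs = pverts G" "i < length vs" "j < length vs"
  shows "adjacency_mat vs G $$ (i, j) + adjacency_mat vs (graph_complement G) $$ (i, j)
    = (if i = j then 0 else 1)"
proof -
  interpret pair_graph G by fact
  have "vs ! i \<in> pverts G" "vs ! j \<in> pverts G"
    unfolding assms(3)[symmetric] using assms(4,5) by simp_all
  moreover have "vs ! i = vs ! j \<longleftrightarrow> i = j" using assms(2,4,5) by (simp add: nth_eq_iff_index_eq)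
  moreover have "(v, v) \<notin> parcs G" for v using pair_no_loops[of "(v, v)"] by auto
  ultimately show ?thesis
    using assms(4,5) by (auto simp: adjacency_mat_def graph_complement_def)
qed

theorem theorem4:
  fixes s n :: nat and G :: "'a pair_pre_digraph"
  assumes "s \<ge> 2" and "n \<ge> 15 * (s - 1)"
    and "pair_graph G" and "card (pverts G) = n"
  shows "\<bar>graph_eigenvalue G s\<bar> + \<bar>graph_eigenvalue (graph_complement G) s\<bar>
           \<le> real n / sqrt (2 * (real s - 1)) - 1"
proof -
  \<comment> \<open>\<open>k\<close> is both the 0-based list position of the s-th eigenvalue and
    the quantity s - 1 in the bound.\<close>
  define k where "k = s - 1"
  have k: "1 \<le> k" "15 * k \<le> n" using assms by (auto simp: k_def)
  have kn: "0 < k" "k < n" using k by auto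
  have "finite (pverts G)" using assms(4) k by (intro card_ge_0_finite) simp
  then obtain vs where vs: "distinct vs" "set vs = pverts G"
    using finite_distinct_list by metis
  have len: "length vs = n" using vs assms(4) distinct_card by metis
  have comp: "pair_graph (graph_complement G)" by (rule pair_graph_complement[OF assms(3)])
  \<comment> \<open>The complement has the same vertices, so one enumeration \<open>vs\<close>
    serves both graphs and the entries of the two matrices can be added position by
    position.\<close>
  define A B where "A = adjacency_mat vs G" and "B = adjacency_mat vs (graph_complement G)"
  have A: "A \<in> carrier_mat n n" "transpose_mat A = A"
    using adjacency_mat_carrier len transpose_adjacency_mat[OF assms(3)] unfolding A_def by auto
  have B: "B \<in> carrier_mat n n" "transpose_mat B = B"
    using adjacency_mat_carrier len transpose_adjacency_mat[OF comp] unfolding B_def by auto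
  have AB: "A $$ (i, j) + B $$ (i, j) = (if i = j then 0 else 1)" if "i < n" "j < n" for i j
    using adjacency_mat_add_complement[OF assms(3) vs] that len unfolding A_def B_def by simp
  have BA: "B $$ (i, j) + A $$ (i, j) = (if i = j then 0 else 1)" if "i < n" "j < n" for i j
    using AB[OF that] by (simp add: add.commute)
  define a b where "a i = eigenvalues_desc A ! i" and "b i = eigenvalues_desc B ! i" for i
  have total: "(\<Sum>i<n. \<Sum>j<n. A $$ (i, j)) + (\<Sum>i<n. \<Sum>j<n. B $$ (i, j)) = real n * (real n - 1)"
  proof -
    have "(\<Sum>i<n. \<Sum>j<n. A $$ (i, j)) + (\<Sum>i<n. \<Sum>j<n. B $$ (i, j))
        = (\<Sum>i<n. \<Sum>j<n. 1 - (if j = i then 1 else 0))"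
      unfolding sum.distrib[symmetric] by (intro sum.cong refl) (simp add: AB)
    also have "\<dots> = real n * (real n - 1)"
      by (simp add: sum_subtractf)
    finally show ?thesis .
  qed
  have sq: "(\<Sum>i<n. (a i)\<^sup>2) + (\<Sum>i<n. (b i)\<^sup>2) = real n * (real n - 1)"
  proof -
    \<comment> \<open>Entries are 0 or 1, hence equal to their squares.\<close>
    have "(\<Sum>i<n. \<Sum>j<n. (A $$ (i, j))\<^sup>2) = (\<Sum>i<n. \<Sum>j<n. A $$ (i, j))"
      by (intro sum.cong refl) (simp add: A_def adjacency_mat_def len)
    moreover have "(\<Sum>i<n. \<Sum>j<n. (B $$ (i, j))\<^sup>2) = (\<Sum>i<n. \<Sum>j<n. B $$ (i, j))"
      by (intro sum.cong refl) (simp add: B_def adjacency_mat_def len)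
    ultimately show ?thesis
      using total unfolding a_def b_def sum_square_eigenvalues_desc[OF A] sum_square_eigenvalues_desc[OF B]
      by simp
  qed
  have top: "real n - 1 \<le> a 0 + b 0"
  proof -
    have "real n * (real n - 1) \<le> real n * (a 0 + b 0)"
      using total entry_sum_le_top_eigenvalue[OF A] entry_sum_le_top_eigenvalue[OF B]
      by (simp add: a_def b_def algebra_simps)
    then show ?thesis using kn by (subst (asm) mult_le_cancel_left_pos) auto
  qed
  have ab: "a k + b (n - k) \<le> -1"
    using complementary_eigenvalues_add_le[OF A B AB kn] by (simp add: a_def b_def)
  have ba: "b k + a (n - k) \<le> -1"
    using complementary_eigenvalues_add_le[OF B A BA kn] by (simp add: a_def b_def)
  have anti_a: "a j \<le> a i" if "i \<le> j" "j < n" for i j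
    unfolding a_def using that symmetric_mat_eigenvalues_desc(1)[OF A] by (intro eigenvalues_desc_antimono) auto
  have anti_b: "b j \<le> b i" if "i \<le> j" "j < n" for i j
    unfolding b_def using that symmetric_mat_eigenvalues_desc(1)[OF B] by (intro eigenvalues_desc_antimono) auto
  have "\<bar>a k\<bar> + \<bar>b k\<bar> \<le> real n / sqrt (2 * real k) - 1"
  proof (cases "a k \<le> b k")
    case True
    then show ?thesis
      using complementary_spectra_bound[of k n a b] k anti_a anti_b sq top ab ba by blast
  next
    case False
    then have "\<bar>b k\<bar> + \<bar>a k\<bar> \<le> real n / sqrt (2 * real k) - 1"
      using complementary_spectra_bound[of k n b a] k anti_a anti_b sq top ab ba
      by (simp add: add.commute)
    then show ?thesis by simp
  qed
  moreover have "real k = real s - 1" using assms(1) by (simp add: k_def of_nat_diff)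
  moreover have "graph_eigenvalue G s = a k"
    using graph_eigenvalue_eq[OF vs] by (simp add: a_def A_def k_def)
  moreover have "graph_eigenvalue (graph_complement G) s = b k"
    using graph_eigenvalue_eq[of vs "graph_complement G"] vs
    by (simp add: b_def B_def k_def graph_complement_def)
  ultimately show ?thesis by simp
qed

end
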